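(* Let $\Sigma$ be a finite alphabet, let $L \subseteq \Sigma^{*}$, and let $\mathcal{A} = (X, \Sigma, \alpha, x_{0}, F)$ be the minimal automaton of $L$. Put $S := \Sigma \cup \{\epsilon\}$ and $\mathcal{U} := \{F, X \setminus F\}$. Then $$h(L) = \eta(\alpha, S, \mathcal{U}) = \eta(\alpha, S).$$
   Context: $\Sigma^{*}$ is the free monoid of words over $\Sigma$, $\epsilon$ is the empty word, and $\Sigma^{(n)}$ is the set of words over $\Sigma$ of length at most $n$. Myhill-Nerode entropy. For finite $E \subseteq \Sigma^{*}$ and $L \subseteq \Sigma^{*}$ let $\Theta(E,L)$ be the equivalence relation on $\Sigma^{*}$ given by $(u,v) \in \Theta(E,L)$ iff for all $w \in E$: $uw \in L \Leftrightarrow vw \in L$. Let $\gamma_{L}(E)$ be the (finite) number of equivalence classes of $\Theta(E,L)$. Define $h(L) := \limsup_{n\to\infty} \frac{1}{n}\log_{2}\gamma_{L}(\Sigma^{(n)})$. Topological automaton. A topological automaton over $\Sigma$ is a tuple $(X,\Sigma,\alpha,x_0,F)$ with $X$ a compact Hausdorff space, $\alpha : X \times \Sigma^{*} \to X$ an action of $\Sigma^{*}$ on $X$ (so $\alpha(x,\epsilon)=x$ and $\alpha(x,uv)=\alpha(\alpha(x,u),v)$) such that each $\alpha_{w} := \alpha(\cdot,w)$ is continuous, $x_0 \in X$, and $F \subseteq X$ clopen. Minimal automaton of $L$. Equip $\{0,1\}^{\Sigma^{*}}$ with the product topology and let $\delta(f,u)(v) := f(uv)$ for $f \in \{0,1\}^{\Sigma^{*}}$,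 $u,v \in \Sigma^{*}$. Let $\chi_{L}$ be the characteristic function of $L$. The minimal automaton of $L$ is $(X,\Sigma,\alpha,x_0,F)$ where $X$ is the closure of $\{\delta(\chi_L,u) \mid u \in \Sigma^{*}\}$ in $\{0,1\}^{\Sigma^{*}}$, $\alpha$ is the restriction of $\delta$ to $X \times \Sigma^{*}$, $x_0 = \chi_L$, and $F = \{f \in X \mid f(\epsilon)=1\}$. Topological entropy. For a compact Hausdorff space $X$ let $\mathcal{C}(X)$ be the set of finite open covers of $X$. For a finite family of covers, $\bigvee_{i \in I}\mathcal{U}_i := \{\bigcap_{i\in I} U_i \mid (U_i)_{i \in I} \in \prod_{i\in I}\mathcal{U}_i\}$. For $\mathcal{U}\in\mathcal{C}(X)$ let $N(\mathcal{U})$ be the minimal cardinality of a subfamily of $\mathcal{U}$ covering $X$. For an action $\alpha$ of $\Sigma^{*}$ on $X$ by continuous maps put $w^{-1}(\mathcal{U}) := \{\alpha_w^{-1}(U) \mid U \in \mathcal{U}\}$, and for finite $E \subseteq \Sigma^{*}$ put $(E:\mathcal{U})_\alpha := N(\bigvee_{w\in E} w^{-1}(\mathcal{U}))$. For a finite generating set $S$ of $\Sigma^{*}$ define $\eta(\alpha,S,\mathcal{U}) := \limsup_{n\to\infty} \frac{1}{n}\log_2 (S^{n}:\mathcal{U})_\alpha$, where $S^n$ is the set of all $n$-fold products of elements of $S$, and $\eta(\alpha,S) := \sup\{\eta(\alpha,S,\mathcal{U}) \mid \mathcal{U}\in\mathcal{C}(X)\}$. (The quantity $\eta(\alpha,S)$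 for the minimal automaton with $S = \Sigma\cup\{\epsilon\}$ is called the topological entropy of $L$.) *)

theory Defs
  imports "HOL-Analysis.Analysis"
begin

text \<open>The free monoid over an alphabet \<open>\<Sigma>\<close> is rendered as \<open>lists \<Sigma>\<close>, with \<open>[]\<close> as unit
  and \<open>@\<close> as product.\<close>

section \<open>Myhill--Nerode entropy\<close>

definition words_upto :: "'a set \<Rightarrow> nat \<Rightarrow> 'a list set" where
  "words_upto \<Sigma> n = {w \<in> lists \<Sigma>. length w \<le> n}"

definition Theta :: "'a set \<Rightarrow> 'a list set \<Rightarrow> 'a list set \<Rightarrow> ('a list \<times> 'a list) set" where
  "Theta \<Sigma> E L =
     {(u, v). u \<in> lists \<Sigma> \<and> v \<in> lists \<Sigma> \<and> (\<forall>w\<in>E. u @ w \<in> L \<longleftrightarrow> v @ w \<in> L)}"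

definition mn_index :: "'a set \<Rightarrow> 'a list set \<Rightarrow> 'a list set \<Rightarrow> nat" where
  "mn_index \<Sigma> L E = card (lists \<Sigma> // Theta \<Sigma> E L)"

definition mn_entropy :: "'a set \<Rightarrow> 'a list set \<Rightarrow> ereal" where
  "mn_entropy \<Sigma> L =
     limsup (\<lambda>n. ereal (1 / real n * log 2 (real (mn_index \<Sigma> L (words_upto \<Sigma> n)))))"


section \<open>Topological automata\<close>

record ('x, 'a) automaton =
  aut_space :: "'x topology"
  aut_alphabet :: "'a set"
  aut_act :: "'x \<Rightarrow> 'a list \<Rightarrow> 'x"
  aut_init :: 'x
  aut_final :: "'x set"

definition continuous_action :: "'x topology \<Rightarrow> 'a set \<Rightarrow> ('x \<Rightarrow> 'a list \<Rightarrow> 'x) \<Rightarrow> bool" where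
  "continuous_action X \<Sigma> \<alpha> \<longleftrightarrow>
     (\<forall>w\<in>lists \<Sigma>. continuous_map X X (\<lambda>x. \<alpha> x w)) \<and>
     (\<forall>x\<in>topspace X. \<alpha> x [] = x) \<and>
     (\<forall>x\<in>topspace X. \<forall>u\<in>lists \<Sigma>. \<forall>v\<in>lists \<Sigma>. \<alpha> x (u @ v) = \<alpha> (\<alpha> x u) v)"

definition topological_automaton :: "('x, 'a) automaton \<Rightarrow> bool" where
  "topological_automaton A \<longleftrightarrow>
     compact_space (aut_space A) \<and> Hausdorff_space (aut_space A) \<and>
     continuous_action (aut_space A) (aut_alphabet A) (aut_act A) \<and>
     aut_init A \<in> topspace (aut_space A) \<and>
     openin (aut_space A) (aut_final A) \<and> closedin (aut_space A) (aut_final A)"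


section \<open>The minimal automaton of a language\<close>

text \<open>Elements of \<open>{0,1}\<^sup>\<Sigma>\<^sup>*\<close> are functions that are \<open>undefined\<close> outside \<open>lists \<Sigma>\<close>; this
  is the carrier of the library's product topology.\<close>

definition full_shift :: "'a set \<Rightarrow> ('a list \<Rightarrow> nat) topology" where
  "full_shift \<Sigma> = product_topology (\<lambda>_. discrete_topology {0, 1}) (lists \<Sigma>)"

definition shift :: "'a set \<Rightarrow> ('a list \<Rightarrow> nat) \<Rightarrow> 'a list \<Rightarrow> ('a list \<Rightarrow> nat)" where
  "shift \<Sigma> f u = (\<lambda>v\<in>lists \<Sigma>. f (u @ v))"

definition char_fun :: "'a set \<Rightarrow> 'a list set \<Rightarrow> ('a list \<Rightarrow> nat)" where
  "char_fun \<Sigma> L = (\<lambda>w\<in>lists \<Sigma>. if w \<in> L then 1 else 0)"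

definition minimal_space :: "'a set \<Rightarrow> 'a list set \<Rightarrow> ('a list \<Rightarrow> nat) topology" where
  "minimal_space \<Sigma> L =
     subtopology (full_shift \<Sigma>)
       (full_shift \<Sigma> closure_of {shift \<Sigma> (char_fun \<Sigma> L) u | u. u \<in> lists \<Sigma>})"

definition minimal_automaton :: "'a set \<Rightarrow> 'a list set \<Rightarrow> ('a list \<Rightarrow> nat, 'a) automaton" where
  "minimal_automaton \<Sigma> L =
     \<lparr> aut_space = minimal_space \<Sigma> L,
       aut_alphabet = \<Sigma>,
       aut_act = (\<lambda>f\<in>topspace (minimal_space \<Sigma> L). \<lambda>u\<in>lists \<Sigma>. shift \<Sigma> f u),
       aut_init = char_fun \<Sigma> L,
       aut_final = {f \<in> topspace (minimal_space \<Sigma> L). f [] = 1} \<rparr>"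

lemma topspace_full_shift: "topspace (full_shift \<Sigma>) = (\<Pi>\<^sub>E w\<in>lists \<Sigma>. {0, 1})"
  by (simp add: full_shift_def)

lemma orbit_subset:
  "{shift \<Sigma> (char_fun \<Sigma> L) u | u. u \<in> lists \<Sigma>} \<subseteq> topspace (full_shift \<Sigma>)"
proof -
  have "shift \<Sigma> (char_fun \<Sigma> L) u \<in> topspace (full_shift \<Sigma>)" if "u \<in> lists \<Sigma>" for u
  proof -
    from that have "u @ v \<in> lists \<Sigma>" if "v \<in> lists \<Sigma>" for v using that by simp
    then show ?thesis
      unfolding topspace_full_shift shift_def char_fun_def by (intro PiE_I) simp_all
  qed
  then show ?thesis by blast
qed

lemma topspace_minimal_space:
  "topspace (minimal_space \<Sigma> L) =
     full_shift \<Sigma> closure_of {shift \<Sigma> (char_fun \<Sigma> L) u | u. u \<in> lists \<Sigma>}"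
  unfolding minimal_space_def
  by (simp add: closure_of_subset_topspace inf_absorb2)

lemma topspace_minimal_subset: "topspace (minimal_space \<Sigma> L) \<subseteq> topspace (full_shift \<Sigma>)"
  by (simp add: topspace_minimal_space closure_of_subset_topspace)

lemma continuous_map_eval:
  assumes "w \<in> lists \<Sigma>"
  shows "continuous_map (full_shift \<Sigma>) (discrete_topology {0, 1}) (\<lambda>f. f w)"
  unfolding full_shift_def
  by (rule continuous_map_product_projection[OF assms])

lemma continuous_map_shift:
  assumes "u \<in> lists \<Sigma>"
  shows "continuous_map (full_shift \<Sigma>) (full_shift \<Sigma>) (\<lambda>f. shift \<Sigma> f u)"
proof -
  have "continuous_map (full_shift \<Sigma>) (discrete_topology {0, 1}) (\<lambda>f. shift \<Sigma> f u v)"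
    if v: "v \<in> lists \<Sigma>" for v
  proof -
    have "u @ v \<in> lists \<Sigma>" using assms v by auto
    from continuous_map_eval[OF this] show ?thesis using v by (simp add: shift_def)
  qed
  then have "continuous_map (full_shift \<Sigma>)
      (product_topology (\<lambda>_. discrete_topology {0, 1}) (lists \<Sigma>)) (\<lambda>f. shift \<Sigma> f u)"
    by (subst continuous_map_componentwise) (auto simp: shift_def)
  then show ?thesis by (simp add: full_shift_def)
qed

lemma shift_Nil: "f \<in> topspace (full_shift \<Sigma>) \<Longrightarrow> shift \<Sigma> f [] = f"
  by (auto simp: shift_def topspace_full_shift PiE_iff extensional_restrict)

lemma shift_append:
  "u \<in> lists \<Sigma> \<Longrightarrow> v \<in> lists \<Sigma> \<Longrightarrow> shift \<Sigma> f (u @ v) = shift \<Sigma> (shift \<Sigma> f u) v"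
  by (rule ext) (auto simp: shift_def restrict_def)

lemma continuous_map_minimal_shift:
  assumes u: "u \<in> lists \<Sigma>"
  shows "continuous_map (minimal_space \<Sigma> L) (minimal_space \<Sigma> L) (\<lambda>f. shift \<Sigma> f u)"
proof -
  let ?O = "{shift \<Sigma> (char_fun \<Sigma> L) u | u. u \<in> lists \<Sigma>}"
  have "shift \<Sigma> (shift \<Sigma> (char_fun \<Sigma> L) v) u \<in> ?O" if v: "v \<in> lists \<Sigma>" for v
  proof -
    have "v @ u \<in> lists \<Sigma>" using u v by simp
    with shift_append[OF v u, of "char_fun \<Sigma> L"] show ?thesis
      by (metis (mono_tags, lifting) mem_Collect_eq)
  qed
  then have "(\<lambda>f. shift \<Sigma> f u) ` ?O \<subseteq> ?O" by blast
  then have "(\<lambda>f. shift \<Sigma> f u) ` (full_shift \<Sigma> closure_of ?O) \<subseteq> full_shift \<Sigma> closure_of ?O"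
    by (rule order_trans[OF
        continuous_map_image_closure_subset[OF continuous_map_shift[OF u]] closure_of_mono])
  moreover have "continuous_map (minimal_space \<Sigma> L) (full_shift \<Sigma>) (\<lambda>f. shift \<Sigma> f u)"
    unfolding minimal_space_def
    by (rule continuous_map_from_subtopology[OF continuous_map_shift[OF u]])
  ultimately show ?thesis
    using topspace_minimal_space[of \<Sigma> L]
    unfolding minimal_space_def continuous_map_in_subtopology by blast
qed

lemma topological_automaton_minimal: "topological_automaton (minimal_automaton \<Sigma> L)"
proof -
  let ?M = "minimal_space \<Sigma> L"
  let ?O = "{shift \<Sigma> (char_fun \<Sigma> L) u | u. u \<in> lists \<Sigma>}"
  have "compact_space (full_shift \<Sigma>)"
    by (simp add: full_shift_def compact_space_product_topology compact_space_discrete_topology)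
  then have "compact_space ?M"
    unfolding minimal_space_def
    by (intro compact_space_subtopology closedin_compact_space) auto
  moreover have "Hausdorff_space ?M"
    unfolding minimal_space_def full_shift_def
    by (intro Hausdorff_space_subtopology)
       (simp add: Hausdorff_space_product_topology)
  moreover have cont: "continuous_map ?M ?M (\<lambda>f. shift \<Sigma> f u)" if "u \<in> lists \<Sigma>" for u
    by (rule continuous_map_minimal_shift[OF that])
  have "continuous_action ?M \<Sigma> (\<lambda>f\<in>topspace ?M. \<lambda>u\<in>lists \<Sigma>. shift \<Sigma> f u)"
    unfolding continuous_action_def
  proof (intro conjI ballI)
    fix u assume u: "u \<in> lists \<Sigma>"
    show "continuous_map ?M ?M (\<lambda>f. (\<lambda>f\<in>topspace ?M. \<lambda>u\<in>lists \<Sigma>. shift \<Sigma> f u) f u)"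
      by (rule continuous_map_eq[OF cont[OF u]]) (use u in simp)
  next
    fix f assume "f \<in> topspace ?M"
    then show "(\<lambda>f\<in>topspace ?M. \<lambda>u\<in>lists \<Sigma>. shift \<Sigma> f u) f [] = f"
      using topspace_minimal_subset shift_Nil by fastforce
  next
    fix f u v assume f: "f \<in> topspace ?M" and uv: "u \<in> lists \<Sigma>" "v \<in> lists \<Sigma>"
    have "shift \<Sigma> f u \<in> topspace ?M"
      using cont[OF uv(1)] f by (auto simp: continuous_map_def)
    moreover have "u @ v \<in> lists \<Sigma>" using uv by auto
    ultimately show "(\<lambda>f\<in>topspace ?M. \<lambda>u\<in>lists \<Sigma>. shift \<Sigma> f u) f (u @ v) =
        (\<lambda>f\<in>topspace ?M. \<lambda>u\<in>lists \<Sigma>. shift \<Sigma> f u)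
          ((\<lambda>f\<in>topspace ?M. \<lambda>u\<in>lists \<Sigma>. shift \<Sigma> f u) f u) v"
      using f uv shift_append[OF uv] by simp
  qed
  moreover have "char_fun \<Sigma> L \<in> topspace ?M"
  proof -
    have "char_fun \<Sigma> L = shift \<Sigma> (char_fun \<Sigma> L) []"
      by (rule sym, rule shift_Nil) (auto simp: topspace_full_shift char_fun_def)
    then have "char_fun \<Sigma> L \<in> ?O" by blast
    then show ?thesis
      using closure_of_subset[OF orbit_subset] unfolding topspace_minimal_space by blast
  qed
  moreover have "openin ?M {f \<in> topspace ?M. f [] = 1} \<and> closedin ?M {f \<in> topspace ?M. f [] = 1}"
  proof -
    have ev: "continuous_map ?M (discrete_topology {0, 1}) (\<lambda>f. f [])"
      unfolding minimal_space_def
      by (rule continuous_map_from_subtopology[OF continuous_map_eval]) simp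
    show ?thesis
      using openin_continuous_map_preimage[OF ev, of "{1}"]
        closedin_continuous_map_preimage[OF ev, of "{1}"] by simp
  qed
  ultimately show ?thesis
    by (simp add: topological_automaton_def minimal_automaton_def)
qed


section \<open>Topological entropy\<close>

definition finite_open_covers :: "'x topology \<Rightarrow> 'x set set set" where
  "finite_open_covers X = {\<U>. finite \<U> \<and> (\<forall>U\<in>\<U>. openin X U) \<and> \<Union>\<U> = topspace X}"

text \<open>Intersecting with \<open>topspace X\<close> only matters for \<open>I = {}\<close>, where the empty intersection
  of subsets of the space is the space itself and not \<open>UNIV\<close>.\<close>

definition cover_join :: "'x topology \<Rightarrow> 'i set \<Rightarrow> ('i \<Rightarrow> 'x set set) \<Rightarrow> 'x set set" where
  "cover_join X I \<U> = {topspace X \<inter> (\<Inter>i\<in>I. U i) | U. U \<in> (\<Pi>\<^sub>E i\<in>I. \<U> i)}"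

definition cover_number :: "'x topology \<Rightarrow> 'x set set \<Rightarrow> nat" where
  "cover_number X \<U> =
     (LEAST k. \<exists>\<V>. \<V> \<subseteq> \<U> \<and> finite \<V> \<and> \<Union>\<V> = topspace X \<and> card \<V> = k)"

definition cover_preimage ::
    "'x topology \<Rightarrow> ('x \<Rightarrow> 'a list \<Rightarrow> 'x) \<Rightarrow> 'a list \<Rightarrow> 'x set set \<Rightarrow> 'x set set" where
  "cover_preimage X \<alpha> w \<U> = {{x \<in> topspace X. \<alpha> x w \<in> U} | U. U \<in> \<U>}"

definition action_cover_number ::
    "'x topology \<Rightarrow> ('x \<Rightarrow> 'a list \<Rightarrow> 'x) \<Rightarrow> 'a list set \<Rightarrow> 'x set set \<Rightarrow> nat" where
  "action_cover_number X \<alpha> E \<U> =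
     cover_number X (cover_join X E (\<lambda>w. cover_preimage X \<alpha> w \<U>))"

definition nfold_products :: "'a list set \<Rightarrow> nat \<Rightarrow> 'a list set" where
  "nfold_products S n = {concat ws | ws. length ws = n \<and> set ws \<subseteq> S}"

definition cover_entropy ::
    "'x topology \<Rightarrow> ('x \<Rightarrow> 'a list \<Rightarrow> 'x) \<Rightarrow> 'a list set \<Rightarrow> 'x set set \<Rightarrow> ereal" where
  "cover_entropy X \<alpha> S \<U> =
     limsup (\<lambda>n. ereal (1 / real n *
       log 2 (real (action_cover_number X \<alpha> (nfold_products S n) \<U>))))"

definition action_entropy ::
    "'x topology \<Rightarrow> ('x \<Rightarrow> 'a list \<Rightarrow> 'x) \<Rightarrow> 'a list set \<Rightarrow> ereal" where
  "action_entropy X \<alpha> S = (SUP \<U>\<in>finite_open_covers X. cover_entropy X \<alpha> S \<U>)"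

end

theory Submission
  imports Defs
begin

text \<open>Two points of the minimal space lie in the same cell of the join of the preimages
  \<open>w\<^sup>-\<^sup>1{F, X - F}\<close> over \<open>w \<in> E\<close> iff they agree on \<open>E\<close>. These cells form a partition, so the
  covering number counts the restrictions to \<open>E\<close> of points of the space; as the orbit of
  \<open>\<chi>\<^sub>L\<close> is dense, every such restriction comes from an orbit point, which makes the count the
  Myhill--Nerode index. Given an arbitrary finite open cover, compactness yields an \<open>m\<close> such that
  each cell over \<open>\<Sigma>\<^sup>(\<^sup>m\<^sup>)\<close> lies in a member of the cover. Hence its \<open>n\<close>-th covering number is at
  most the \<open>(n + m)\<close>-th index, and the shift by \<open>m\<close> disappears in the limit superior.\<close>

section \<open>Quotients and covers\<close>

text \<open>The classes are the fibres of \<open>f\<close> over its values. Such fibres are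
  nonempty, so each determines its value.\<close>

lemma card_quotient_fibres:
  "card (A // {(x, y). x \<in> A \<and> y \<in> A \<and> f x = f y}) = card (f ` A)"
proof -
  let ?r = "{(x, y). x \<in> A \<and> y \<in> A \<and> f x = f y}"
  let ?g = "\<lambda>b. {x \<in> A. f x = b}"
  have "A // ?r = ?g ` f ` A"
    by (force simp: quotient_def image_iff)
  moreover have "inj_on ?g (f ` A)"
    by (rule inj_onI) blast
  ultimately show ?thesis
    by (simp add: card_image)
qed

lemma cover_number_le_card:
  assumes "\<V> \<subseteq> \<U>" "finite \<V>" "\<Union>\<V> = topspace X"
  shows "cover_number X \<U> \<le> card \<V>"
  unfolding cover_number_def by (rule Least_le) (use assms in blast)

text \<open>Replacing each member of the refinement by a member of \<U> that contains it gives a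
  subcover with no more elements. The family \<C> itself may lie outside \<U>.\<close>

lemma cover_number_le_refinement:
  assumes "finite \<C>" "topspace X \<subseteq> \<Union>\<C>"
    and sub: "\<And>C. C \<in> \<C> \<Longrightarrow> \<exists>U\<in>\<U>. C \<subseteq> U"
    and top: "\<And>U. U \<in> \<U> \<Longrightarrow> U \<subseteq> topspace X"
  shows "cover_number X \<U> \<le> card \<C>"
proof -
  obtain h where h: "\<And>C. C \<in> \<C> \<Longrightarrow> h C \<in> \<U> \<and> C \<subseteq> h C"
    using sub by metis
  have "\<Union>(h ` \<C>) = topspace X"
  proof
    show "\<Union>(h ` \<C>) \<subseteq> topspace X"
      using h top by (simp add: UN_subset_iff)
    have "\<Union>\<C> \<subseteq> \<Union>(h ` \<C>)"
      using h by (intro Union_least) blast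
    with assms(2) show "topspace X \<subseteq> \<Union>(h ` \<C>)"
      by (rule subset_trans)
  qed
  then have "cover_number X \<U> \<le> card (h ` \<C>)"
    using h assms(1) by (intro cover_number_le_card) auto
  also have "\<dots> \<le> card \<C>"
    using assms(1) by (rule card_image_le)
  finally show ?thesis .
qed

text \<open>In a disjoint family a nonempty member has points that no other member covers, so every
  subcover contains it. The empty set is discounted because a minimal subcover drops it.\<close>

lemma cover_number_partition:
  assumes fin: "finite (\<C> - {{}})" and un: "\<Union>\<C> = topspace X" and dis: "disjoint \<C>"
  shows "cover_number X \<C> = card (\<C> - {{}})"
  unfolding cover_number_def
proof (rule Least_equality)
  show "\<exists>\<V>. \<V> \<subseteq> \<C> \<and> finite \<V> \<and> \<Union>\<V> = topspace X \<and> card \<V> = card (\<C> - {{}})"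
    using fin un by (intro exI[of _ "\<C> - {{}}"]) auto
next
  fix k assume "\<exists>\<V>. \<V> \<subseteq> \<C> \<and> finite \<V> \<and> \<Union>\<V> = topspace X \<and> card \<V> = k"
  then obtain \<V> where V: "\<V> \<subseteq> \<C>" "finite \<V>" "\<Union>\<V> = topspace X" "card \<V> = k"
    by blast
  have "\<C> - {{}} \<subseteq> \<V>"
  proof
    fix C assume C: "C \<in> \<C> - {{}}"
    then obtain x where "x \<in> C" by blast
    moreover then obtain D where "D \<in> \<V>" "x \<in> D"
      using C un V(3) by blast
    ultimately have "C = D"
      using dis C V(1) unfolding disjoint_def by blast
    with \<open>D \<in> \<V>\<close> show "C \<in> \<V>" by simp
  qed
  with V show "card (\<C> - {{}}) \<le> k"
    by (metis card_mono)
qed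

section \<open>Words\<close>

lemma words_upto_subset: "words_upto \<Sigma> n \<subseteq> lists \<Sigma>"
  by (auto simp: words_upto_def)

lemma finite_words_upto: "finite \<Sigma> \<Longrightarrow> finite (words_upto \<Sigma> n)"
  using finite_lists_length_le[of \<Sigma> n] by (simp add: words_upto_def lists_eq_set)

lemma words_upto_append:
  "u \<in> words_upto \<Sigma> n \<Longrightarrow> v \<in> words_upto \<Sigma> m \<Longrightarrow> u @ v \<in> words_upto \<Sigma> (n + m)"
  by (auto simp: words_upto_def)

lemma words_upto_mono: "m \<le> n \<Longrightarrow> words_upto \<Sigma> m \<subseteq> words_upto \<Sigma> n"
  by (auto simp: words_upto_def)

lemma nfold_products_letters:
  "nfold_products ((\<lambda>a. [a]) ` \<Sigma> \<union> {[]}) n = words_upto \<Sigma> n"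
proof (intro equalityI subsetI)
  fix w assume "w \<in> nfold_products ((\<lambda>a. [a]) ` \<Sigma> \<union> {[]}) n"
  then obtain ws where ws: "w = concat ws" "length ws = n"
      "set ws \<subseteq> (\<lambda>a. [a]) ` \<Sigma> \<union> {[]}"
    by (auto simp: nfold_products_def)
  from ws(3) have "concat ws \<in> lists \<Sigma> \<and> length (concat ws) \<le> length ws"
    by (induction ws) auto
  with ws show "w \<in> words_upto \<Sigma> n"
    by (simp add: words_upto_def)
next
  fix w assume w: "w \<in> words_upto \<Sigma> n"
  \<comment> \<open>Shorter words are padded with empty factors to reach exactly \<open>n\<close> of
    them.\<close>
  let ?ws = "map (\<lambda>a. [a]) w @ replicate (n - length w) []"
  have "w = concat ?ws" "length ?ws = n" "set ?ws \<subseteq> (\<lambda>a. [a]) ` \<Sigma> \<union> {[]}"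
    using w by (auto simp: words_upto_def concat_replicate_trivial)
  then show "w \<in> nfold_products ((\<lambda>a. [a]) ` \<Sigma> \<union> {[]}) n"
    unfolding nfold_products_def by (intro CollectI exI[of _ ?ws] conjI)
qed

section \<open>Cells of the minimal space\<close>

text \<open>By default the classical reasoner and the simplifier expand \<open>w \<in> lists \<Sigma>\<close> into a statement
  about the letters of \<open>w\<close>, which hides it from the rules below.\<close>

declare in_lists_conv_set [simp del] in_listsD [rule del] in_listsI [rule del]

text \<open>The centre \<open>f\<close> matters only through its values on \<open>E\<close>. It may
  lie outside the space, so that arbitrary bit patterns on \<open>E\<close> can index cells, some of
  them empty.\<close>

definition cell :: "'a set \<Rightarrow> 'a list set \<Rightarrow> 'a list set \<Rightarrow> ('a list \<Rightarrow> nat) \<Rightarrow>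
    ('a list \<Rightarrow> nat) set" where
  "cell \<Sigma> L E f = {g \<in> topspace (minimal_space \<Sigma> L). restrict g E = restrict f E}"

lemma cell_iff:
  "g \<in> cell \<Sigma> L E f \<longleftrightarrow> g \<in> topspace (minimal_space \<Sigma> L) \<and> (\<forall>w\<in>E. g w = f w)"
  by (auto simp: cell_def restrict_def fun_eq_iff)

lemma minimal_space_value:
  "f \<in> topspace (minimal_space \<Sigma> L) \<Longrightarrow> w \<in> lists \<Sigma> \<Longrightarrow> f w \<in> {0, 1}"
  using topspace_minimal_subset[of \<Sigma> L] unfolding topspace_full_shift by (blast dest: PiE_mem)

lemma restrict_minimal_space:
  assumes "f \<in> topspace (minimal_space \<Sigma> L)" "E \<subseteq> lists \<Sigma>"
  shows "restrict f E \<in> (\<Pi>\<^sub>E w\<in>E. {0, 1})"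
  unfolding restrict_PiE_iff using minimal_space_value[OF assms(1)] assms(2) by blast

lemma shift_in_minimal_space:
  "f \<in> topspace (minimal_space \<Sigma> L) \<Longrightarrow> u \<in> lists \<Sigma> \<Longrightarrow> shift \<Sigma> f u \<in> topspace (minimal_space \<Sigma> L)"
  using continuous_map_minimal_shift[of u \<Sigma> L] by (auto simp: continuous_map_def)

lemma char_fun_in_minimal_space: "char_fun \<Sigma> L \<in> topspace (minimal_space \<Sigma> L)"
  using topological_automaton_minimal[of \<Sigma> L]
  by (simp add: topological_automaton_def minimal_automaton_def)

lemma minimal_space_subtopology:
  "subtopology (full_shift \<Sigma>) (topspace (minimal_space \<Sigma> L)) = minimal_space \<Sigma> L"
  unfolding topspace_minimal_space unfolding minimal_space_def ..

lemma compact_minimal_space: "compact_space (minimal_space \<Sigma> L)"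
  using topological_automaton_minimal[of \<Sigma> L]
  by (simp add: topological_automaton_def minimal_automaton_def)

section \<open>Cylinders and density of the orbit\<close>

text \<open>Cells are taken inside the minimal space; cylinders live in the full shift, where the
  closure defining that space is formed.\<close>

definition cylinder :: "'a set \<Rightarrow> 'a list set \<Rightarrow> ('a list \<Rightarrow> nat) \<Rightarrow> ('a list \<Rightarrow> nat) set" where
  "cylinder \<Sigma> E f = {g \<in> topspace (full_shift \<Sigma>). \<forall>w\<in>E. g w = f w}"

lemma openin_cylinder:
  assumes "finite E" "E \<subseteq> lists \<Sigma>"
  shows "openin (full_shift \<Sigma>) (cylinder \<Sigma> E f)"
proof -
  \<comment> \<open>A box constrained only at the finitely many words of \<open>E\<close>. The
    intersection with \<open>{0, 1}\<close> keeps each factor inside the discrete space when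
    \<open>f w\<close> is not a bit.\<close>
  let ?U = "\<lambda>w. if w \<in> E then {0, 1} \<inter> {f w} else {0, 1}"
  have "cylinder \<Sigma> E f = Pi\<^sub>E (lists \<Sigma>) ?U"
  proof (rule set_eqI)
    fix g
    have "(\<forall>w\<in>lists \<Sigma>. g w \<in> ?U w) \<longleftrightarrow> (\<forall>w\<in>lists \<Sigma>. g w \<in> {0, 1}) \<and> (\<forall>w\<in>E. g w = f w)"
      using assms(2) by (auto split: if_splits)
    then show "g \<in> cylinder \<Sigma> E f \<longleftrightarrow> g \<in> Pi\<^sub>E (lists \<Sigma>) ?U"
      by (simp only: cylinder_def topspace_full_shift PiE_iff mem_Collect_eq conj_ac)
  qed
  moreover have "{w \<in> lists \<Sigma>. ?U w \<noteq> {0, 1}} \<subseteq> E"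
    by auto
  then have "finite {w \<in> lists \<Sigma>. ?U w \<noteq> {0, 1}}"
    using assms(1) by (rule finite_subset)
  ultimately show ?thesis
    by (auto simp: full_shift_def openin_PiE_gen openin_discrete_topology
        simp del: insert_iff One_nat_def)
qed

lemma openin_cell:
  assumes "finite E" "E \<subseteq> lists \<Sigma>"
  shows "openin (minimal_space \<Sigma> L) (cell \<Sigma> L E f)"
proof -
  have "cell \<Sigma> L E f = cylinder \<Sigma> E f \<inter> topspace (minimal_space \<Sigma> L)"
    using topspace_minimal_subset[of \<Sigma> L] by (auto simp only: cell_iff cylinder_def)
  then show ?thesis
    using openin_subtopology_Int[OF openin_cylinder[OF assms], of "topspace (minimal_space \<Sigma> L)" f]
    by (simp only: minimal_space_subtopology)
qed

text \<open>The cylinder around \<open>f\<close> over \<open>E\<close> is an open neighbourhood of a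
  point in the closure of the orbit, hence contains an orbit point.\<close>

lemma orbit_meets_cell:
  assumes "finite E" "E \<subseteq> lists \<Sigma>" "f \<in> topspace (minimal_space \<Sigma> L)"
  obtains u where "u \<in> lists \<Sigma>" "\<And>w. w \<in> E \<Longrightarrow> char_fun \<Sigma> L (u @ w) = f w"
proof -
  have "f \<in> cylinder \<Sigma> E f"
    using assms(3) topspace_minimal_subset by (auto simp only: cylinder_def)
  moreover have "\<forall>T. f \<in> T \<and> openin (full_shift \<Sigma>) T \<longrightarrow>
      (\<exists>g. g \<in> {shift \<Sigma> (char_fun \<Sigma> L) u | u. u \<in> lists \<Sigma>} \<and> g \<in> T)"
    using assms(3) unfolding topspace_minimal_space in_closure_of by (rule conjunct2)
  ultimately have "\<exists>g. g \<in> {shift \<Sigma> (char_fun \<Sigma> L) u | u. u \<in> lists \<Sigma>} \<and> g \<in> cylinder \<Sigma> E f"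
    using openin_cylinder[OF assms(1,2)] by simp
  then obtain u where u: "u \<in> lists \<Sigma>" "\<forall>w\<in>E. shift \<Sigma> (char_fun \<Sigma> L) u w = f w"
    unfolding cylinder_def by blast
  then have "char_fun \<Sigma> L (u @ w) = f w" if "w \<in> E" for w
    using that assms(2) by (metis restrict_apply' shift_def subsetD)
  with u(1) that show thesis by blast
qed

section \<open>Patterns on a finite window and the Myhill-Nerode index\<close>

text \<open>The analogue of the patterns of a subshift on the window \<open>E\<close>. Their number
  links the Myhill-Nerode index with the covering numbers.\<close>

definition traces :: "'a set \<Rightarrow> 'a list set \<Rightarrow> 'a list set \<Rightarrow> ('a list \<Rightarrow> nat) set" where
  "traces \<Sigma> L E = (\<lambda>f. restrict f E) ` topspace (minimal_space \<Sigma> L)"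

lemma finite_traces:
  assumes "finite E" "E \<subseteq> lists \<Sigma>"
  shows "finite (traces \<Sigma> L E)"
proof (rule finite_subset)
  show "traces \<Sigma> L E \<subseteq> (\<Pi>\<^sub>E w\<in>E. {0, 1})"
    unfolding traces_def using restrict_minimal_space[OF _ assms(2)] by (rule image_subsetI)
  show "finite (\<Pi>\<^sub>E w\<in>E. {0, 1 :: nat})"
    using assms(1) by (intro finite_PiE) auto
qed

text \<open>The point \<chi>_L always leaves a trace. Positivity is what comparing logarithms
  requires of the larger count.\<close>

lemma card_traces_pos:
  assumes "finite E" "E \<subseteq> lists \<Sigma>"
  shows "card (traces \<Sigma> L E) > 0"
  using finite_traces[OF assms, of L] char_fun_in_minimal_space[of \<Sigma> L]
  by (auto simp: card_gt_0_iff traces_def)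

text \<open>\<open>Theta\<close> is the kernel of the map sending a word \<open>u\<close> to the
  trace of \<chi>_L shifted by \<open>u\<close>, and density of the orbit makes this map onto the
  traces.\<close>

lemma mn_index_eq_card_traces:
  assumes "finite E" "E \<subseteq> lists \<Sigma>"
  shows "mn_index \<Sigma> L E = card (traces \<Sigma> L E)"
proof -
  let ?f = "\<lambda>u. restrict (shift \<Sigma> (char_fun \<Sigma> L) u) E"
  have val: "shift \<Sigma> (char_fun \<Sigma> L) u w = (if u @ w \<in> L then 1 else 0)"
    if "u \<in> lists \<Sigma>" "w \<in> E" for u w
    using that assms(2) by (auto simp: shift_def char_fun_def)
  have "?f u = ?f v \<longleftrightarrow> (\<forall>w\<in>E. u @ w \<in> L \<longleftrightarrow> v @ w \<in> L)"
    if "u \<in> lists \<Sigma>" "v \<in> lists \<Sigma>" for u v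
  proof -
    have "?f u = ?f v \<longleftrightarrow>
        (\<forall>w\<in>E. shift \<Sigma> (char_fun \<Sigma> L) u w = shift \<Sigma> (char_fun \<Sigma> L) v w)"
      by (auto simp: restrict_def fun_eq_iff)
    then show ?thesis
      using val that by (metis zero_neq_one)
  qed
  then have "Theta \<Sigma> E L = {(u, v). u \<in> lists \<Sigma> \<and> v \<in> lists \<Sigma> \<and> ?f u = ?f v}"
    unfolding Theta_def by blast
  moreover have "?f ` lists \<Sigma> = traces \<Sigma> L E"
  proof (intro equalityI subsetI)
    fix r assume "r \<in> ?f ` lists \<Sigma>"
    then show "r \<in> traces \<Sigma> L E"
      by (auto simp: traces_def intro!: imageI shift_in_minimal_space char_fun_in_minimal_space)
  next
    fix r assume "r \<in> traces \<Sigma> L E"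
    then obtain f where f: "f \<in> topspace (minimal_space \<Sigma> L)" "r = restrict f E"
      unfolding traces_def by blast
    obtain u where u: "u \<in> lists \<Sigma>" "\<And>w. w \<in> E \<Longrightarrow> char_fun \<Sigma> L (u @ w) = f w"
      using orbit_meets_cell[OF assms f(1)] by blast
    then have "r = ?f u"
      using f(2) assms(2) by (auto simp: restrict_def fun_eq_iff shift_def)
    with u(1) show "r \<in> ?f ` lists \<Sigma>" by blast
  qed
  ultimately show ?thesis
    unfolding mn_index_def by (simp only: card_quotient_fibres)
qed

lemma cells_eq_image_traces:
  "cell \<Sigma> L E ` topspace (minimal_space \<Sigma> L) =
     (\<lambda>r. {g \<in> topspace (minimal_space \<Sigma> L). restrict g E = r}) ` traces \<Sigma> L E"
  by (simp only: cell_def[abs_def] traces_def image_image)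

text \<open>A trace can be read off from any point of its cell, so distinct traces have distinct
  cells.\<close>

lemma card_cells:
  "card (cell \<Sigma> L E ` topspace (minimal_space \<Sigma> L)) = card (traces \<Sigma> L E)"
  unfolding cells_eq_image_traces
  by (rule card_image, rule inj_onI) (auto simp: traces_def)

section \<open>Covering numbers of the minimal automaton\<close>

lemma aut_space_minimal: "aut_space (minimal_automaton \<Sigma> L) = minimal_space \<Sigma> L"
  by (simp add: minimal_automaton_def)

lemma aut_act_minimal:
  "f \<in> topspace (minimal_space \<Sigma> L) \<Longrightarrow> u \<in> lists \<Sigma> \<Longrightarrow>
    aut_act (minimal_automaton \<Sigma> L) f u = shift \<Sigma> f u"
  by (simp add: minimal_automaton_def)

text \<open>Acting by \<open>w\<close> moves the value at \<open>w\<close> to the empty word, and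
  membership in the final set tests the value there. Hence the preimages are the two sets fixing the
  bit at \<open>w\<close>.\<close>

lemma final_preimage:
  assumes "w \<in> lists \<Sigma>"
  shows "cover_preimage (minimal_space \<Sigma> L) (aut_act (minimal_automaton \<Sigma> L)) w
      {aut_final (minimal_automaton \<Sigma> L),
       topspace (minimal_space \<Sigma> L) - aut_final (minimal_automaton \<Sigma> L)} =
    (\<lambda>b. {f \<in> topspace (minimal_space \<Sigma> L). f w = b}) ` {0, 1}"
proof -
  let ?X = "topspace (minimal_space \<Sigma> L)" and ?A = "minimal_automaton \<Sigma> L"
  have in_final: "aut_act ?A f w \<in> aut_final ?A \<longleftrightarrow> f w = 1"
    and in_space: "aut_act ?A f w \<in> ?X" if "f \<in> ?X" for f
    using that assms aut_act_minimal[OF that assms] shift_in_minimal_space[OF that assms]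
    by (auto simp: minimal_automaton_def shift_def)
  have "{f \<in> ?X. aut_act ?A f w \<in> aut_final ?A} = {f \<in> ?X. f w = 1}"
    using in_final by blast
  moreover have "{f \<in> ?X. aut_act ?A f w \<in> ?X - aut_final ?A} = {f \<in> ?X. f w = 0}"
    using in_final in_space minimal_space_value[OF _ assms] by fastforce
  \<comment> \<open>The complement is listed first, matching the order of the bits \<open>0\<close>
    and \<open>1\<close>.\<close>
  moreover have "cover_preimage (minimal_space \<Sigma> L) (aut_act ?A) w {aut_final ?A, ?X - aut_final ?A} =
      {{f \<in> ?X. aut_act ?A f w \<in> ?X - aut_final ?A}, {f \<in> ?X. aut_act ?A f w \<in> aut_final ?A}}"
    unfolding cover_preimage_def by blast
  ultimately show ?thesis
    by (simp only: image_insert image_empty)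
qed

text \<open>Selecting one preimage for each \<open>w\<close> in \<open>E\<close> is the same as
  selecting a bit for each \<open>w\<close>, and intersecting the selected sets gives the cell of
  that bit pattern.\<close>

lemma final_join:
  assumes "E \<subseteq> lists \<Sigma>"
  shows "cover_join (minimal_space \<Sigma> L) E (\<lambda>w. cover_preimage (minimal_space \<Sigma> L)
      (aut_act (minimal_automaton \<Sigma> L)) w
      {aut_final (minimal_automaton \<Sigma> L),
       topspace (minimal_space \<Sigma> L) - aut_final (minimal_automaton \<Sigma> L)}) =
    cell \<Sigma> L E ` (\<Pi>\<^sub>E w\<in>E. {0, 1})"
    (is "cover_join ?M E ?P = _")
proof (intro equalityI subsetI)
  let ?X = "topspace ?M"
  have P: "?P w = (\<lambda>b. {f \<in> ?X. f w = b}) ` {0, 1}" if "w \<in> E" for w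
    using final_preimage that assms by blast
  {
    fix C assume "C \<in> cover_join ?M E ?P"
    then obtain U where U: "U \<in> (\<Pi>\<^sub>E w\<in>E. ?P w)" "C = ?X \<inter> (\<Inter>w\<in>E. U w)"
      unfolding cover_join_def by blast
    have "\<forall>w\<in>E. \<exists>b. b \<in> {0, 1} \<and> U w = {f \<in> ?X. f w = b}"
      using P PiE_mem[OF U(1)] by blast
    from bchoice[OF this] obtain b
      where b: "\<And>w. w \<in> E \<Longrightarrow> b w \<in> {0, 1} \<and> U w = {f \<in> ?X. f w = b w}"
      by blast
    \<comment> \<open>The chosen \<open>b\<close> is arbitrary off \<open>E\<close>; restricting it
      makes it a member of the extensional product.\<close>
    have "C = cell \<Sigma> L E (restrict b E)"
      using b U(2) by (auto simp: cell_iff)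
    then show "C \<in> cell \<Sigma> L E ` (\<Pi>\<^sub>E w\<in>E. {0, 1})"
      using b by (intro image_eqI[of _ _ "restrict b E"]) auto
  next
    fix C assume "C \<in> cell \<Sigma> L E ` (\<Pi>\<^sub>E w\<in>E. {0, 1})"
    then obtain b where b: "b \<in> (\<Pi>\<^sub>E w\<in>E. {0, 1})" "C = cell \<Sigma> L E b"
      by blast
    let ?U = "\<lambda>w\<in>E. {f \<in> ?X. f w = b w}"
    have "{f \<in> ?X. f w = b w} \<in> ?P w" if "w \<in> E" for w
      unfolding P[OF that] using PiE_mem[OF b(1) that] by (rule imageI)
    then have "?U \<in> (\<Pi>\<^sub>E w\<in>E. ?P w)"
      unfolding restrict_PiE_iff by (rule ballI)
    moreover have "C = ?X \<inter> (\<Inter>w\<in>E. ?U w)"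
      using b(2) by (auto simp: cell_iff)
    ultimately show "C \<in> cover_join ?M E ?P"
      unfolding cover_join_def by blast
  }
qed

text \<open>Cells over the same \<open>E\<close> are fibres of restriction to \<open>E\<close>, so
  they partition the space and the covering number counts the nonempty ones.\<close>

lemma action_cover_number_final:
  assumes "finite E" "E \<subseteq> lists \<Sigma>"
  shows "action_cover_number (minimal_space \<Sigma> L) (aut_act (minimal_automaton \<Sigma> L)) E
      {aut_final (minimal_automaton \<Sigma> L),
       topspace (minimal_space \<Sigma> L) - aut_final (minimal_automaton \<Sigma> L)} =
    card (traces \<Sigma> L E)"
proof -
  let ?X = "topspace (minimal_space \<Sigma> L)"
  let ?C = "cell \<Sigma> L E ` (\<Pi>\<^sub>E w\<in>E. {0, 1})"
  have self: "f \<in> cell \<Sigma> L E f" "cell \<Sigma> L E (restrict f E) = cell \<Sigma> L E f"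
      "restrict f E \<in> (\<Pi>\<^sub>E w\<in>E. {0, 1})" if "f \<in> ?X" for f
    using that restrict_minimal_space[OF that assms(2)] by (simp_all add: cell_def)
  \<comment> \<open>Any point of a nonempty cell can serve as its centre.\<close>
  have nonempty: "?C - {{}} = cell \<Sigma> L E ` ?X"
  proof (intro equalityI subsetI)
    fix C assume "C \<in> ?C - {{}}"
    then obtain b f where bf: "C = cell \<Sigma> L E b" "f \<in> C" by blast
    then have "f \<in> ?X" "C = cell \<Sigma> L E f"
      by (auto simp: cell_def)
    then show "C \<in> cell \<Sigma> L E ` ?X" by blast
  next
    fix C assume "C \<in> cell \<Sigma> L E ` ?X"
    then obtain f where f: "f \<in> ?X" "C = cell \<Sigma> L E f" by blast
    with self[of f] show "C \<in> ?C - {{}}"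
      by (simp only: Diff_iff) (metis empty_iff image_eqI singletonD)
  qed
  have "finite (?C - {{}})"
    unfolding nonempty cells_eq_image_traces using finite_traces[OF assms] by (rule finite_imageI)
  moreover have "\<Union>?C = ?X"
  proof
    show "\<Union>?C \<subseteq> ?X" by (auto simp: cell_def)
    show "?X \<subseteq> \<Union>?C"
    proof
      \<comment> \<open>The point \<open>f\<close> enters the index set through its restriction to
        \<open>E\<close>, which has the same cell.\<close>
      fix f assume f: "f \<in> ?X"
      have "cell \<Sigma> L E f \<in> ?C"
        using imageI[OF self(3)[OF f], of "cell \<Sigma> L E"] unfolding self(2)[OF f] .
      then show "f \<in> \<Union>?C"
        using self(1)[OF f] by (rule UnionI)
    qed
  qed
  moreover have "disjoint ?C"
    unfolding disjoint_def by (auto simp: cell_def)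
  ultimately show ?thesis
    unfolding action_cover_number_def final_join[OF assms(2)]
    by (simp only: cover_number_partition nonempty card_cells)
qed

section \<open>Arbitrary covers\<close>

text \<open>A basic neighbourhood of \<open>f\<close> inside the open set constrains finitely many
  coordinates. Agreement with \<open>f\<close> on all words up to their greatest length implies
  membership.\<close>

lemma small_cell_at:
  assumes "openin (minimal_space \<Sigma> L) V" "f \<in> V"
  obtains m where "cell \<Sigma> L (words_upto \<Sigma> m) f \<subseteq> V"
proof -
  let ?X = "topspace (minimal_space \<Sigma> L)"
  have "openin (subtopology (full_shift \<Sigma>) ?X) V"
    using assms(1) by (simp only: minimal_space_subtopology)
  then obtain T where T: "openin (full_shift \<Sigma>) T" "V = T \<inter> ?X"
    unfolding openin_subtopology by blast
  have "f \<in> T" using assms(2) T by blast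
  then obtain U where U: "finite {w \<in> lists \<Sigma>. U w \<noteq> {0, 1 :: nat}}"
      "f \<in> Pi\<^sub>E (lists \<Sigma>) U" "Pi\<^sub>E (lists \<Sigma>) U \<subseteq> T"
    using T(1) unfolding full_shift_def openin_product_topology_alt by auto
  let ?D = "{w \<in> lists \<Sigma>. U w \<noteq> {0, 1 :: nat}}"
  \<comment> \<open>Inserting \<open>0\<close> covers the case of no constrained coordinate.\<close>
  define m where "m = Max (insert 0 (length ` ?D))"
  have D: "?D \<subseteq> words_upto \<Sigma> m"
    using U(1) by (auto simp: words_upto_def m_def intro!: Max_ge)
  have "g \<in> Pi\<^sub>E (lists \<Sigma>) U" if g: "g \<in> cell \<Sigma> L (words_upto \<Sigma> m) f" for g
  proof (rule PiE_I)
    fix w assume w: "w \<in> lists \<Sigma>"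
    show "g w \<in> U w"
    proof (cases "w \<in> ?D")
      case True
      with D have "w \<in> words_upto \<Sigma> m" by (rule subsetD)
      with g have "g w = f w" by (simp add: cell_iff)
      with PiE_mem[OF U(2) w] show ?thesis by simp
    next
      case False
      with w have "U w = {0, 1}" by simp
      moreover have "g w \<in> {0, 1}"
        using g by (intro minimal_space_value[OF _ w, of _ L]) (simp add: cell_iff)
      ultimately show ?thesis by simp
    qed
  next
    fix w assume "w \<notin> lists \<Sigma>"
    moreover have "g \<in> topspace (full_shift \<Sigma>)"
      using g topspace_minimal_subset[of \<Sigma> L] by (auto simp only: cell_iff)
    ultimately show "g w = undefined"
      unfolding topspace_full_shift by (intro PiE_arb)
  qed
  then have "cell \<Sigma> L (words_upto \<Sigma> m) f \<subseteq> Pi\<^sub>E (lists \<Sigma>) U"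
    by (rule subsetI)
  with U(3) have "cell \<Sigma> L (words_upto \<Sigma> m) f \<subseteq> T"
    by (rule subset_trans[rotated])
  then have "cell \<Sigma> L (words_upto \<Sigma> m) f \<subseteq> V"
    unfolding T(2) by (simp add: cell_def subset_iff)
  then show thesis by (rule that)
qed

text \<open>A Lebesgue number argument: finitely many cells with individual radii \<open>k f\<close>
  cover the space, and \<open>m\<close> is the largest radius. As in an ultrametric space, every
  point of a cell is a centre of it, so the finer cell of \<open>g\<close> stays within the cell of
  \<open>f\<close> that contains \<open>g\<close>.\<close>

lemma small_cells:
  assumes "finite \<Sigma>" "\<V> \<in> finite_open_covers (minimal_space \<Sigma> L)"
  obtains m where
    "\<forall>f\<in>topspace (minimal_space \<Sigma> L). \<exists>V\<in>\<V>. cell \<Sigma> L (words_upto \<Sigma> m) f \<subseteq> V"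
proof -
  let ?X = "topspace (minimal_space \<Sigma> L)"
  have "\<exists>m. \<exists>V\<in>\<V>. cell \<Sigma> L (words_upto \<Sigma> m) f \<subseteq> V" if "f \<in> ?X" for f
  proof -
    from that assms(2) obtain V where V: "V \<in> \<V>" "openin (minimal_space \<Sigma> L) V" "f \<in> V"
      unfolding finite_open_covers_def by blast
    from small_cell_at[OF V(2,3)] obtain m where "cell \<Sigma> L (words_upto \<Sigma> m) f \<subseteq> V" .
    with V(1) show ?thesis by blast
  qed
  then obtain k where k: "\<And>f. f \<in> ?X \<Longrightarrow> \<exists>V\<in>\<V>. cell \<Sigma> L (words_upto \<Sigma> (k f)) f \<subseteq> V"
    by metis
  let ?c = "\<lambda>f. cell \<Sigma> L (words_upto \<Sigma> (k f)) f"
  \<comment> \<open>Since the alphabet is finite, each window \<open>words_upto\<close> is finite,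
    which makes the cells open.\<close>
  have "\<forall>C\<in>?c ` ?X. openin (minimal_space \<Sigma> L) C"
    by (auto intro!: openin_cell finite_words_upto assms(1) words_upto_subset)
  moreover have "?X \<subseteq> \<Union>(?c ` ?X)"
    by (auto simp: cell_iff)
  ultimately have "\<exists>\<F>. finite \<F> \<and> \<F> \<subseteq> ?c ` ?X \<and> ?X \<subseteq> \<Union>\<F>"
    using compact_minimal_space[of \<Sigma> L, unfolded compact_space_alt, rule_format] by simp
  then obtain \<F> where \<F>: "finite \<F>" "\<F> \<subseteq> ?c ` ?X" "?X \<subseteq> \<Union>\<F>"
    by blast
  obtain K where K: "finite K" "K \<subseteq> ?X" "\<F> = ?c ` K"
    using finite_subset_image[OF \<F>(1,2)] by blast
  define m where "m = Max (insert 0 (k ` K))"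
  have "\<exists>V\<in>\<V>. cell \<Sigma> L (words_upto \<Sigma> m) g \<subseteq> V" if g: "g \<in> ?X" for g
  proof -
    obtain f where f: "f \<in> K" "g \<in> ?c f"
      using g \<F>(3) K(3) by blast
    have "k f \<le> m"
      using K(1) f(1) by (simp add: m_def)
    from words_upto_mono[OF this, of \<Sigma>] have "cell \<Sigma> L (words_upto \<Sigma> m) g \<subseteq> ?c f"
      using f(2) by (fastforce simp: cell_iff)
    moreover obtain V where "V \<in> \<V>" "?c f \<subseteq> V"
      using k[of f] f(1) K(2) by blast
    ultimately show ?thesis by blast
  qed
  then show thesis by (intro that ballI)
qed

text \<open>The coordinate \<open>v\<close> after shifting by \<open>u\<close> is the coordinate
  \<open>u @ v\<close> before, and the length of \<open>u @ v\<close> is at most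
  \<open>n + m\<close>.\<close>

lemma shift_cell:
  assumes "u \<in> words_upto \<Sigma> n" "g \<in> cell \<Sigma> L (words_upto \<Sigma> (n + m)) f"
  shows "shift \<Sigma> g u \<in> cell \<Sigma> L (words_upto \<Sigma> m) (shift \<Sigma> f u)"
proof -
  have "u \<in> lists \<Sigma>" using assms(1) words_upto_subset by (rule rev_subsetD)
  moreover have "shift \<Sigma> g u v = shift \<Sigma> f u v" if "v \<in> words_upto \<Sigma> m" for v
    using assms words_upto_append[OF assms(1) that] by (auto simp: shift_def cell_iff)
  ultimately show ?thesis
    using assms(2) shift_in_minimal_space by (auto simp: cell_iff)
qed

text \<open>The cells over words of length at most \<open>n + m\<close> refine the join: every
  \<open>w\<close> of length at most \<open>n\<close> carries such a cell into a cell over length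
  \<open>m\<close>, hence into one member of \<V>.\<close>

lemma action_cover_number_le:
  assumes "finite \<Sigma>"
    and small: "\<And>f. f \<in> topspace (minimal_space \<Sigma> L) \<Longrightarrow>
      \<exists>V\<in>\<V>. cell \<Sigma> L (words_upto \<Sigma> m) f \<subseteq> V"
  shows "action_cover_number (minimal_space \<Sigma> L) (aut_act (minimal_automaton \<Sigma> L))
      (words_upto \<Sigma> n) \<V> \<le> card (traces \<Sigma> L (words_upto \<Sigma> (n + m)))"
proof -
  let ?M = "minimal_space \<Sigma> L"
  let ?X = "topspace ?M" and ?W = "words_upto \<Sigma> n" and ?a = "aut_act (minimal_automaton \<Sigma> L)"
  let ?P = "\<lambda>w. cover_preimage ?M ?a w \<V>"
  let ?C = "cell \<Sigma> L (words_upto \<Sigma> (n + m)) ` ?X"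
  obtain V where V: "\<And>f. f \<in> ?X \<Longrightarrow> V f \<in> \<V> \<and> cell \<Sigma> L (words_upto \<Sigma> m) f \<subseteq> V f"
    using small by metis
  have "cover_number ?M (cover_join ?M ?W ?P) \<le> card ?C"
  proof (rule cover_number_le_refinement)
    show "finite ?C"
      using finite_traces[OF finite_words_upto[OF assms(1)] words_upto_subset]
      by (simp add: cells_eq_image_traces)
    show "?X \<subseteq> \<Union>?C" by (auto simp: cell_iff)
    show "U \<subseteq> ?X" if "U \<in> cover_join ?M ?W ?P" for U
      using that by (auto simp: cover_join_def)
    fix C assume "C \<in> ?C"
    then obtain f where f: "f \<in> ?X" "C = cell \<Sigma> L (words_upto \<Sigma> (n + m)) f" by blast
    \<comment> \<open>For each \<open>w\<close>, the selected member of \<V> is the one that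
      contains the small cell around the image of the centre \<open>f\<close>.\<close>
    let ?U = "\<lambda>w\<in>?W. {g \<in> ?X. ?a g w \<in> V (shift \<Sigma> f w)}"
    have "?U \<in> (\<Pi>\<^sub>E w\<in>?W. ?P w)"
    proof (intro restrict_PiE_iff[THEN iffD2] ballI)
      fix w assume "w \<in> ?W"
      then have "shift \<Sigma> f w \<in> ?X"
        using words_upto_subset by (intro shift_in_minimal_space f(1)) (rule subsetD)
      then have "V (shift \<Sigma> f w) \<in> \<V>"
        using V by simp
      then show "{g \<in> ?X. ?a g w \<in> V (shift \<Sigma> f w)} \<in> ?P w"
        unfolding cover_preimage_def by blast
    qed
    then have "?X \<inter> (\<Inter>w\<in>?W. ?U w) \<in> cover_join ?M ?W ?P"
      unfolding cover_join_def by blast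
    moreover have "C \<subseteq> ?X \<inter> (\<Inter>w\<in>?W. ?U w)"
    proof
      fix g assume g: "g \<in> C"
      then have gX: "g \<in> ?X" using f(2) by (simp add: cell_iff)
      have "?a g w \<in> V (shift \<Sigma> f w)" if w: "w \<in> ?W" for w
      proof -
        have wl: "w \<in> lists \<Sigma>" using w words_upto_subset by (rule rev_subsetD)
        have "shift \<Sigma> g w \<in> cell \<Sigma> L (words_upto \<Sigma> m) (shift \<Sigma> f w)"
          using shift_cell[OF w] g f(2) by simp
        also have "\<dots> \<subseteq> V (shift \<Sigma> f w)"
          using V shift_in_minimal_space[OF f(1) wl] by simp
        finally show ?thesis
          by (simp only: aut_act_minimal[OF gX wl])
      qed
      with gX show "g \<in> ?X \<inter> (\<Inter>w\<in>?W. ?U w)" by simp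
    qed
    ultimately show "\<exists>U\<in>cover_join ?M ?W ?P. C \<subseteq> U" by blast
  qed
  then show ?thesis
    unfolding action_cover_number_def card_cells .
qed

section \<open>Growth rates\<close>

text \<open>Write \<open>1 / n\<close> as \<open>(1 + m / n) * (1 / (n + m))\<close>. The first
  factor tends to 1, and a shift of the index leaves the limit superior unchanged.\<close>

lemma limsup_growth_shift:
  fixes c :: "nat \<Rightarrow> real"
  shows "limsup (\<lambda>n. ereal (1 / real n * c (n + m))) = limsup (\<lambda>n. ereal (1 / real n * c n))"
proof -
  have "(\<lambda>n. 1 + real m / real n) \<longlonglongrightarrow> 1 + 0"
    by (intro tendsto_intros lim_const_over_n)
  then have lim: "(\<lambda>n. ereal (1 + real m / real n)) \<longlonglongrightarrow> 1"
    by (simp add: one_ereal_def)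
  \<comment> \<open>Only for positive \<open>n\<close>: at \<open>n = 0\<close> division by zero
    makes the left side \<open>0\<close>, while the right side may differ.\<close>
  have "\<forall>\<^sub>F n in sequentially. ereal (1 / real n * c (n + m)) =
      ereal (1 + real m / real n) * ereal (1 / real (n + m) * c (n + m))"
    using eventually_gt_at_top[of 0]
  proof eventually_elim
    fix n :: nat assume "0 < n"
    then have "1 + real m / real n = real (n + m) / real n"
      by (simp add: add_divide_distrib)
    then show "ereal (1 / real n * c (n + m)) =
        ereal (1 + real m / real n) * ereal (1 / real (n + m) * c (n + m))"
      using \<open>0 < n\<close> by simp
  qed
  then have "limsup (\<lambda>n. ereal (1 / real n * c (n + m))) =
      limsup (\<lambda>n. ereal (1 + real m / real n) * ereal (1 / real (n + m) * c (n + m)))"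
    by (rule Limsup_eq)
  \<comment> \<open>The factor can be pulled out because its limit is positive and finite, even if
    the limit superior is infinite.\<close>
  also have "\<dots> = 1 * limsup (\<lambda>n. ereal (1 / real (n + m) * c (n + m)))"
    by (rule ereal_limsup_lim_mult[OF lim]) auto
  also have "\<dots> = limsup (\<lambda>n. ereal (1 / real n * c n))"
    using limsup_shift_k[of "\<lambda>n. ereal (1 / real n * c n)" m] by simp
  finally show ?thesis .
qed

text \<open>The case \<open>a = 0\<close> relies on the junk value \<open>log 2 0 = 0\<close>.\<close>

lemma log_of_nat_mono:
  assumes "a \<le> b" "0 < b"
  shows "log 2 (real a) \<le> log 2 (real b)"
proof (cases "a = 0")
  case True
  then show ?thesis
    using assms(2) by (simp add: log_def)
next
  case False
  then show ?thesis
    using assms by (intro log_mono) auto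
qed

theorem theorem3p10:
  fixes \<Sigma> :: "'a set" and L :: "'a list set"
    and A :: "('a list \<Rightarrow> nat, 'a) automaton"
    and S :: "'a list set" and \<U> :: "('a list \<Rightarrow> nat) set set"
  assumes "finite \<Sigma>"
    and "L \<subseteq> lists \<Sigma>"
    and "A = minimal_automaton \<Sigma> L"
    and "S = (\<lambda>a. [a]) ` \<Sigma> \<union> {[]}"
    and "\<U> = {aut_final A, topspace (aut_space A) - aut_final A}"
  shows "mn_entropy \<Sigma> L = cover_entropy (aut_space A) (aut_act A) S \<U> \<and>
         cover_entropy (aut_space A) (aut_act A) S \<U> = action_entropy (aut_space A) (aut_act A) S"
proof
  let ?M = "minimal_space \<Sigma> L"
  let ?c = "\<lambda>n. log 2 (real (card (traces \<Sigma> L (words_upto \<Sigma> n))))"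
  have space: "aut_space A = ?M"
    using assms(3) by (simp add: aut_space_minimal)
  have products: "nfold_products S n = words_upto \<Sigma> n" for n
    unfolding assms(4) by (rule nfold_products_letters)
  note fin = finite_words_upto[OF assms(1)]
  have mn: "mn_entropy \<Sigma> L = limsup (\<lambda>n. ereal (1 / real n * ?c n))"
    unfolding mn_entropy_def by (simp add: mn_index_eq_card_traces[OF fin words_upto_subset])
  have cov: "cover_entropy (aut_space A) (aut_act A) S \<U> = limsup (\<lambda>n. ereal (1 / real n * ?c n))"
    unfolding cover_entropy_def products space assms(5)
    by (simp add: assms(3) action_cover_number_final[OF fin words_upto_subset])
  show "mn_entropy \<Sigma> L = cover_entropy (aut_space A) (aut_act A) S \<U>"
    using mn cov by simp
  \<comment> \<open>The final set is clopen, so its complement is open too. Thus \<U> takes part in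
    the supremum, and it remains to show that no other cover exceeds it.\<close>
  have "\<U> \<in> finite_open_covers (aut_space A)"
    using topological_automaton_minimal[of \<Sigma> L] openin_subset
    unfolding finite_open_covers_def topological_automaton_def assms(5) assms(3)
    by (auto simp: openin_diff)
  moreover have "cover_entropy (aut_space A) (aut_act A) S \<V> \<le>
      cover_entropy (aut_space A) (aut_act A) S \<U>"
    if V: "\<V> \<in> finite_open_covers (aut_space A)" for \<V>
  proof -
    obtain m where small: "\<forall>f\<in>topspace ?M. \<exists>V\<in>\<V>. cell \<Sigma> L (words_upto \<Sigma> m) f \<subseteq> V"
      by (rule small_cells[OF assms(1) V[unfolded space]])
    have "log 2 (real (action_cover_number ?M (aut_act A) (words_upto \<Sigma> n) \<V>)) \<le> ?c (n + m)" for n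
      unfolding assms(3)
      by (intro log_of_nat_mono action_cover_number_le[OF assms(1) bspec[OF small]]
          card_traces_pos[OF fin words_upto_subset])
    then have "cover_entropy (aut_space A) (aut_act A) S \<V> \<le>
        limsup (\<lambda>n. ereal (1 / real n * ?c (n + m)))"
      unfolding cover_entropy_def products space
      \<comment> \<open>The termwise bound includes \<open>n = 0\<close>, where both sides are
        \<open>0\<close>.\<close>
      by (intro Limsup_mono always_eventually allI) (simp add: divide_right_mono)
    also have "\<dots> = cover_entropy (aut_space A) (aut_act A) S \<U>"
      unfolding cov by (rule limsup_growth_shift)
    finally show ?thesis .
  qed
  ultimately show "cover_entropy (aut_space A) (aut_act A) S \<U> =
      action_entropy (aut_space A) (aut_act A) S"
    unfolding action_entropy_def by (intro antisym SUP_upper SUP_least)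
qed

end
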